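(* For every integer $d\ge1$, every $d$-dimensional brick $B\subseteq\mathbb{R}^\infty$ is P-Ramsey.
   Context: $\mathbb{R}^\infty$ denotes the subspace of $\ell^2$ of real sequences with only finitely many nonzero entries, with the Euclidean metric. A configuration is a set of points of $\mathbb{R}^\infty$. A copy of a configuration $B$ (a configuration congruent to $B$) is a configuration $B'$ for which there is a distance-preserving bijection $B\to B'$. A configuration $Z$ is $X$-free if no subset of $Z$ is a copy of $X$. For configurations $A,B$ and an integer $r\ge1$, $A\rightarrow(B)_r$ means that every coloring of the points of $A$ with $r$ colors admits a monochromatic subset of $A$ that is a copy of $B$. A configuration $B\subseteq\mathbb{R}^\infty$ is a $d$-dimensional brick if there exist positive real numbers $a_1,\ldots,a_d$ such that $B$ is congruent to $\{(x_1,\ldots,x_d): x_i=0\text{ or }x_i=a_i,\ 1\le i\le d\}$. A finite configuration $X\subseteq\mathbb{R}^\infty$ is P-Ramsey if there exist a configuration $Y\subseteq\mathbb{R}^\infty$ and a real number $\mu>0$ such that: (i) $Y\rightarrow(X)_r$ for every integer $r\ge1$; (ii) every finite $Y'\subseteq Y$ contains a subset $Z\subseteq Y'$ with $|Z|\ge\mu|Y'|$ such that $Z$ is $X$-free. *)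

theory Defs
  imports Complex_Main
begin

text \<open>
  \<open>Rinf\<close> is the space of finitely supported real sequences, with the metric of the
  sequence space of square-summable sequences. All configurations below are subsets of \<open>Rinf\<close>;
  the series defining \<open>l2dist\<close> is only meaningful for square-summable differences, in particular
  on \<open>Rinf\<close>, where it is a finite sum.
\<close>

definition Rinf :: "(nat \<Rightarrow> real) set" where
  "Rinf = {x. finite {i. x i \<noteq> 0}}"

definition l2dist :: "(nat \<Rightarrow> real) \<Rightarrow> (nat \<Rightarrow> real) \<Rightarrow> real" where
  "l2dist x y = sqrt (\<Sum>i. (x i - y i)\<^sup>2)"

definition congruent_to :: "(nat \<Rightarrow> real) set \<Rightarrow> (nat \<Rightarrow> real) set \<Rightarrow> bool" where
  "congruent_to B B' \<longleftrightarrow>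
     (\<exists>f. bij_betw f B B' \<and> (\<forall>x\<in>B. \<forall>y\<in>B. l2dist (f x) (f y) = l2dist x y))"

definition config_free :: "(nat \<Rightarrow> real) set \<Rightarrow> (nat \<Rightarrow> real) set \<Rightarrow> bool" where
  "config_free X Z \<longleftrightarrow> (\<nexists>S. S \<subseteq> Z \<and> congruent_to X S)"

definition arrows :: "(nat \<Rightarrow> real) set \<Rightarrow> (nat \<Rightarrow> real) set \<Rightarrow> nat \<Rightarrow> bool" where
  "arrows A B r \<longleftrightarrow>
     (\<forall>c :: (nat \<Rightarrow> real) \<Rightarrow> nat. c ` A \<subseteq> {..<r} \<longrightarrow>
        (\<exists>S k. S \<subseteq> A \<and> congruent_to B S \<and> (\<forall>x\<in>S. c x = k)))"

text \<open>The coordinates are indexed from 0, so the box lives in coordinates \<open>0, \<dots>, d - 1\<close>;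
  only the values \<open>a 0, \<dots>, a (d - 1)\<close> matter.\<close>

definition box_vertices :: "nat \<Rightarrow> (nat \<Rightarrow> real) \<Rightarrow> (nat \<Rightarrow> real) set" where
  "box_vertices d a = {x. (\<forall>i<d. x i = 0 \<or> x i = a i) \<and> (\<forall>i\<ge>d. x i = 0)}"

definition is_brick :: "nat \<Rightarrow> (nat \<Rightarrow> real) set \<Rightarrow> bool" where
  "is_brick d B \<longleftrightarrow>
     B \<subseteq> Rinf \<and> (\<exists>a. (\<forall>i<d. 0 < a i) \<and> congruent_to B (box_vertices d a))"

definition P_Ramsey :: "(nat \<Rightarrow> real) set \<Rightarrow> bool" where
  "P_Ramsey X \<longleftrightarrow>
     X \<subseteq> Rinf \<and> finite X \<and>
     (\<exists>Y \<mu>. Y \<subseteq> Rinf \<and> (0::real) < \<mu> \<and>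
        (\<forall>r\<ge>1. arrows Y X r) \<and>
        (\<forall>Y'. Y' \<subseteq> Y \<and> finite Y' \<longrightarrow>
           (\<exists>Z. Z \<subseteq> Y' \<and> real (card Z) \<ge> \<mu> * real (card Y') \<and> config_free X Z)))"

end

theory Submission
  imports Defs "HOL-Library.Ramsey" "HOL-Library.Nat_Bijection"
begin

text \<open>
  Put the pair \<open>i < j\<close> at \<open>(e\<^sub>i - e\<^sub>j) / sqrt 6\<close>. Two pairs are then at distance at most 1, with
  equality exactly if they are consecutive, i.e. of the form \<open>(i, j)\<close>, \<open>(j, k)\<close> (the edges of the
  shift graph). Let \<open>Y\<close> be the product of \<open>d\<close> such sets, the \<open>t\<close>-th one scaled by \<open>a\<^sub>t\<close>. By Ramsey's
  theorem for \<open>2d\<close>-subsets, every finite colouring of \<open>Y\<close> has a monochromatic brick, whose \<open>t\<close>-th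
  coordinate is one of \<open>(i\<^sub>t, j\<^sub>t)\<close>, \<open>(j\<^sub>t, k\<^sub>t)\<close>. On the other hand, the length of the diagonal of the
  brick is the diameter of \<open>Y\<close> and is attained only by points that are consecutive in every
  coordinate. Given a finite \<open>Y'\<close>, choose a random set \<open>A\<close> of naturals and keep those points whose
  first pair \<open>(i, j)\<close> has \<open>i \<in> A\<close>, \<open>j \<notin> A\<close>: on average this keeps a quarter of \<open>Y'\<close>, and no two of
  the remaining points are consecutive in the first coordinate.
\<close>

subsection \<open>Product of shift graphs\<close>

text \<open>\<open>prod_decode\<close> makes room for \<open>d\<close> mutually orthogonal blocks in
  one sequence: the index coding \<open>(t, m)\<close> is coordinate \<open>m\<close> of block
  \<open>t\<close>. The divisor \<open>sqrt 6\<close> normalises the largest value of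
  \<open>pair_dist2\<close> on increasing pairs.\<close>

definition shift_point :: "nat \<Rightarrow> (nat \<Rightarrow> real) \<Rightarrow> (nat \<Rightarrow> nat) \<Rightarrow> (nat \<Rightarrow> nat) \<Rightarrow> nat \<Rightarrow> real" where
  "shift_point d a f g n =
     (case prod_decode n of (t, m) \<Rightarrow>
        if t < d then a t / sqrt 6 * (of_bool (m = f t) - of_bool (m = g t)) else 0)"

definition shift_config :: "nat \<Rightarrow> (nat \<Rightarrow> real) \<Rightarrow> (nat \<Rightarrow> real) set" where
  "shift_config d a = {shift_point d a f g | f g. \<forall>t<d. f t < g t}"

text \<open>The squared distance of \<open>e\<^sub>i - e\<^sub>j\<close> and \<open>e\<^sub>k - e\<^sub>l\<close>, provided that \<open>i \<noteq> j\<close> and \<open>k \<noteq> l\<close>.\<close>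

definition pair_dist2 :: "nat \<Rightarrow> nat \<Rightarrow> nat \<Rightarrow> nat \<Rightarrow> real" where
  "pair_dist2 i j k l =
     4 - 2 * of_bool (i = k) - 2 * of_bool (j = l) + 2 * of_bool (i = l) + 2 * of_bool (j = k)"

text \<open>For increasing pairs, \<open>i = l\<close> and \<open>j = k\<close> exclude each other,
  so at most one of the positive corrections to 4 occurs.\<close>

lemma pair_dist2_le:
  assumes "i < j" "k < l"
  shows "pair_dist2 i j k l \<le> 6"
  using assms by (auto simp: pair_dist2_def of_bool_def)

lemma pair_dist2_eq_6_iff:
  assumes "i < j" "k < l"
  shows "pair_dist2 i j k l = 6 \<longleftrightarrow> i = l \<or> j = k"
  using assms by (auto simp: pair_dist2_def of_bool_def)

lemma sum_pair_dist2:
  assumes "finite M" "{i, j, k, l} \<subseteq> M" "i \<noteq> j" "k \<noteq> l"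
  shows "(\<Sum>m\<in>M. ((of_bool (m = i) - of_bool (m = j)) - (of_bool (m = k) - of_bool (m = l)))\<^sup>2)
           = pair_dist2 i j k l"
proof -
  have delta: "(\<Sum>m\<in>M. of_bool (m = x \<and> x = y)) = (of_bool (x = y) :: real)" if "x \<in> M" for x y
    using assms(1) that by (cases "x = y") (simp_all add: of_bool_def sum.delta)
  \<comment> \<open>The trivial conjuncts \<open>i = i\<close> make \<open>delta\<close> apply to the squares as well.\<close>
  have "(\<Sum>m\<in>M. ((of_bool (m = i) - of_bool (m = j)) - (of_bool (m = k) - of_bool (m = l)))\<^sup>2)
      = (\<Sum>m\<in>M. of_bool (m = i \<and> i = i) + of_bool (m = j \<and> j = j) + of_bool (m = k \<and> k = k)
          + of_bool (m = l \<and> l = l) - 2 * of_bool (m = i \<and> i = k) - 2 * of_bool (m = j \<and> j = l)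
          + 2 * of_bool (m = i \<and> i = l) + 2 * (of_bool (m = j \<and> j = k) :: real))"
    using assms(3,4) by (intro sum.cong refl) (auto simp: of_bool_def)
  also have "\<dots> = pair_dist2 i j k l"
    using assms(2)
    by (simp only: sum.distrib sum_subtractf delta insert_subset flip: sum_distrib_left)
       (simp add: pair_dist2_def)
  finally show ?thesis .
qed

lemma shift_config_subset_Rinf: "shift_config d a \<subseteq> Rinf"
proof
  fix y assume "y \<in> shift_config d a"
  then obtain f g where y: "y = shift_point d a f g"
    by (auto simp: shift_config_def)
  have "n \<in> prod_encode ` (SIGMA t:{..<d}. {f t, g t})" if "y n \<noteq> 0" for n
  proof (rule image_eqI)
    show "n = prod_encode (prod_decode n)" by simp
    show "prod_decode n \<in> (SIGMA t:{..<d}. {f t, g t})"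
      using that by (auto simp: y shift_point_def split: prod.splits if_splits)
  qed
  then have "{n. y n \<noteq> 0} \<subseteq> prod_encode ` (SIGMA t:{..<d}. {f t, g t})" by blast
  then show "y \<in> Rinf"
    unfolding Rinf_def by (simp add: finite_subset)
qed

lemma l2dist_shift_point:
  assumes "\<And>t. t < d \<Longrightarrow> f t < g t" "\<And>t. t < d \<Longrightarrow> f' t < g' t"
  shows "l2dist (shift_point d a f g) (shift_point d a f' g')
           = sqrt (\<Sum>t<d. (a t)\<^sup>2 / 6 * pair_dist2 (f t) (g t) (f' t) (g' t))"
proof -
  let ?M = "\<lambda>t. {f t, g t, f' t, g' t}"
  let ?S = "SIGMA t:{..<d}. ?M t"
  let ?h = "\<lambda>n. (shift_point d a f g n - shift_point d a f' g' n)\<^sup>2"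
  have zero: "?h n = 0" if "n \<notin> prod_encode ` ?S" for n
  proof -
    obtain t m where n: "n = prod_encode (t, m)"
      by (metis prod_decode_inverse surj_pair)
    then have "(t, m) \<notin> ?S" using that by blast
    then show ?thesis by (auto simp: n shift_point_def)
  qed
  have "(\<Sum>n. ?h n) = sum ?h (prod_encode ` ?S)"
    by (intro suminf_finite zero) auto
  also have "\<dots> = (\<Sum>p\<in>?S. ?h (prod_encode p))"
    by (subst sum.reindex) (auto intro: inj_onI)
  also have "\<dots> = (\<Sum>t<d. \<Sum>m\<in>?M t. ?h (prod_encode (t, m)))"
    by (subst sum.Sigma) (auto simp: case_prod_unfold)
  also have "\<dots> = (\<Sum>t<d. (a t)\<^sup>2 / 6 * pair_dist2 (f t) (g t) (f' t) (g' t))"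
  proof (rule sum.cong[OF refl])
    fix t assume t: "t \<in> {..<d}"
    have "(\<Sum>m\<in>?M t. ?h (prod_encode (t, m)))
        = (\<Sum>m\<in>?M t. (a t)\<^sup>2 / 6 * ((of_bool (m = f t) - of_bool (m = g t))
             - (of_bool (m = f' t) - of_bool (m = g' t)))\<^sup>2)"
      using t by (intro sum.cong refl)
        (simp add: shift_point_def power_mult_distrib power_divide flip: right_diff_distrib)
    also have "\<dots> = (a t)\<^sup>2 / 6 * pair_dist2 (f t) (g t) (f' t) (g' t)"
      using assms[of t] t by (subst sum_distrib_left[symmetric], subst sum_pair_dist2) auto
    finally show "(\<Sum>m\<in>?M t. ?h (prod_encode (t, m)))
        = (a t)\<^sup>2 / 6 * pair_dist2 (f t) (g t) (f' t) (g' t)" .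
  qed
  finally show ?thesis unfolding l2dist_def by simp
qed

lemma diameter_attained_imp_consecutive:
  assumes fg: "\<And>t. t < d \<Longrightarrow> f t < g t" "\<And>t. t < d \<Longrightarrow> f' t < g' t"
    and a: "\<And>t. t < d \<Longrightarrow> a t \<noteq> 0"
    and dist: "l2dist (shift_point d a f g) (shift_point d a f' g') = sqrt (\<Sum>t<d. (a t)\<^sup>2)"
    and t: "t < d"
  shows "f t = g' t \<or> g t = f' t"
proof -
  let ?p = "\<lambda>t. pair_dist2 (f t) (g t) (f' t) (g' t)"
  have le: "(a s)\<^sup>2 / 6 * ?p s \<le> (a s)\<^sup>2" if "s < d" for s
    using mult_left_mono[OF pair_dist2_le[OF fg(1)[OF that] fg(2)[OF that]], of "(a s)\<^sup>2 / 6"]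
    by simp
  have eq: "(\<Sum>s<d. (a s)\<^sup>2 / 6 * ?p s) = (\<Sum>s<d. (a s)\<^sup>2)"
    using dist by (simp add: l2dist_shift_point[OF fg])
  \<comment> \<open>By \<open>le\<close> no summand is negative, so a zero sum forces equality in
    every coordinate.\<close>
  have "(\<Sum>s<d. (a s)\<^sup>2 - (a s)\<^sup>2 / 6 * ?p s) = 0"
    using eq by (simp add: sum_subtractf)
  then have "(a t)\<^sup>2 - (a t)\<^sup>2 / 6 * ?p t = 0"
    using le t by (subst (asm) sum_nonneg_eq_0_iff) auto
  then have "?p t = 6" using a[OF t] by (simp add: field_simps)
  then show ?thesis using pair_dist2_eq_6_iff fg t by blast
qed

subsection \<open>Boxes\<close>

lemma finite_box_vertices: "finite (box_vertices d a)"
proof -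
  have "box_vertices d a \<subseteq> (\<lambda>I t. if t \<in> I then a t else 0) ` Pow {..<d}"
  proof
    fix v assume v: "v \<in> box_vertices d a"
    have "v = (\<lambda>t. if t \<in> {s. s < d \<and> v s \<noteq> 0} then a t else 0)"
      using v by (fastforce simp: box_vertices_def fun_eq_iff not_less)
    then show "v \<in> (\<lambda>I t. if t \<in> I then a t else 0) ` Pow {..<d}"
      by (rule image_eqI) auto
  qed
  then show ?thesis by (rule finite_subset) simp
qed

lemma l2dist_box_vertices:
  assumes "v \<in> box_vertices d a" "w \<in> box_vertices d a"
  shows "l2dist v w = sqrt (\<Sum>t<d. (v t - w t)\<^sup>2)"
  using assms unfolding l2dist_def box_vertices_def
  by (subst suminf_finite[of "{..<d}"]) auto

lemma box_diagonal:
  "\<exists>v\<in>box_vertices d a. \<exists>w\<in>box_vertices d a. l2dist v w = sqrt (\<Sum>t<d. (a t)\<^sup>2)"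
proof -
  let ?v = "\<lambda>t. if t < d then a t else 0"
  have v: "?v \<in> box_vertices d a" and w: "(\<lambda>_. 0) \<in> box_vertices d a"
    by (auto simp: box_vertices_def)
  have "l2dist ?v (\<lambda>_. 0) = sqrt (\<Sum>t<d. (a t)\<^sup>2)"
    by (subst l2dist_box_vertices[OF v w]) simp
  with v w show ?thesis by blast
qed

lemma congruent_to_trans:
  assumes "congruent_to A B" "congruent_to B C"
  shows "congruent_to A C"
proof -
  from assms obtain f g where f: "bij_betw f A B" "\<And>x y. x \<in> A \<Longrightarrow> y \<in> A \<Longrightarrow> l2dist (f x) (f y) = l2dist x y"
    and g: "bij_betw g B C" "\<And>x y. x \<in> B \<Longrightarrow> y \<in> B \<Longrightarrow> l2dist (g x) (g y) = l2dist x y"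
    unfolding congruent_to_def by blast
  then show ?thesis
    unfolding congruent_to_def using bij_betw_trans[OF f(1) g(1)] bij_betwE[OF f(1)]
    by (intro exI[of _ "g \<circ> f"]) auto
qed

subsection \<open>Monochromatic boxes\<close>

text \<open>The \<open>t\<close>-th coordinate of the image of a vertex is the pair of the elements number \<open>3t\<close>, \<open>3t + 1\<close>
  or \<open>3t + 1\<close>, \<open>3t + 2\<close> of a homogeneous set, so every vertex uses \<open>2d\<close> increasing elements.\<close>

lemma arrows_shift_config_box:
  assumes a: "\<And>t. t < d \<Longrightarrow> 0 < a t"
  shows "arrows (shift_config d a) (box_vertices d a) r"
  unfolding arrows_def
proof (intro allI impI)
  fix c :: "(nat \<Rightarrow> real) \<Rightarrow> nat"
  assume c: "c ` shift_config d a \<subseteq> {..<r}"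
  \<comment> \<open>\<open>P\<close> turns the colouring of points into one of
    \<open>2 * d\<close>-sets: the elements of rank \<open>2 * t\<close> and
    \<open>2 * t + 1\<close> form the pair in block \<open>t\<close>.\<close>
  define P where "P X = shift_point d a (\<lambda>t. sorted_list_of_set X ! (2 * t))
                          (\<lambda>t. sorted_list_of_set X ! (2 * t + 1))" for X
  have "P X \<in> shift_config d a" if "finite X" "card X = 2 * d" for X
    unfolding P_def shift_config_def using that
    by (fastforce intro!: sorted_wrt_nth_less[OF strict_sorted_list_of_set])
  with c have "\<forall>X. X \<subseteq> UNIV \<and> finite X \<and> card X = 2 * d \<longrightarrow> c (P X) < r"
    by blast
  from Ramsey[OF infinite_UNIV_nat this] obtain H k where H: "infinite H"
    and k: "\<forall>X. X \<subseteq> H \<and> finite X \<and> card X = 2 * d \<longrightarrow> c (P X) = k"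
    by (elim exE conjE)
  define s where "s = enumerate H"
  have s_less: "s i < s j \<longleftrightarrow> i < j" and s_in: "s i \<in> H" for i j
    using H by (auto simp: s_def enumerate_in_set)
  have s_eq: "s i = s j \<longleftrightarrow> i = j" for i j
    using s_less by (metis less_irrefl linorder_neqE_nat)
  define e :: "(nat \<Rightarrow> real) \<Rightarrow> nat \<Rightarrow> nat" where "e v t = of_bool (v t \<noteq> 0)" for v t
  define f where "f v t = s (3 * t + e v t)" for v t
  define g where "g v t = s (3 * t + e v t + 1)" for v t
  define \<phi> where "\<phi> v = shift_point d a (f v) (g v)" for v
  have fg: "f v t < g v t" for v t
    by (simp add: f_def g_def s_less)
  have colour: "\<phi> v \<in> shift_config d a \<and> c (\<phi> v) = k" for v
  proof
    show "\<phi> v \<in> shift_config d a"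
      unfolding \<phi>_def shift_config_def using fg by blast
    \<comment> \<open>\<open>x\<close> interleaves the pairs of \<open>v\<close>:
      \<open>x (2 * t) = f v t\<close> and \<open>x (2 * t + 1) = g v t\<close>. Once
      \<open>x\<close> is known to increase, \<open>P\<close> recovers \<open>\<phi> v\<close> from
      its first \<open>2 * d\<close> values.\<close>
    define x where "x n = s (3 * (n div 2) + n mod 2 + e v (n div 2))" for n
    have x_mono: "x m < x n" if "m < n" for m n
    proof -
      have "3 * (m div 2) + m mod 2 + e v (m div 2) < 3 * (n div 2) + n mod 2 + e v (n div 2)"
      proof (cases "m div 2 = n div 2")
        case True
        moreover have "m mod 2 < n mod 2" using True that by presburger
        ultimately show ?thesis by simp
      next
        \<comment> \<open>The last index that block \<open>t\<close> can use is
          \<open>3 * t + 2\<close>, just below the start of the next block.\<close>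
        case False
        then have "m div 2 + 1 \<le> n div 2" using that div_le_mono[of m n 2] by linarith
        moreover have "e v (m div 2) \<le> 1" by (simp add: e_def)
        moreover have "m mod 2 \<le> 1" by simp
        ultimately show ?thesis by linarith
      qed
      then show ?thesis by (simp add: x_def s_less)
    qed
    then have inj: "inj_on x {..<2 * d}"
      by (metis inj_onI less_irrefl linorder_neqE_nat)
    have "sorted_wrt (<) (map x [0..<2 * d])"
      by (auto simp: sorted_wrt_iff_nth_less x_mono)
    then have list: "sorted_list_of_set (x ` {..<2 * d}) = map x [0..<2 * d]"
      by (intro sorted_list_of_set_unique[THEN iffD1])
         (use inj in \<open>auto simp: card_image lessThan_atLeast0\<close>)
    have "P (x ` {..<2 * d}) = \<phi> v"
      unfolding P_def \<phi>_def list shift_point_def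
      by (rule ext) (auto simp: x_def f_def g_def split: prod.splits)
    moreover have "x ` {..<2 * d} \<subseteq> H"
      by (auto simp: x_def s_in)
    then have "c (P (x ` {..<2 * d})) = k"
      using k card_image[OF inj] by simp
    ultimately show "c (\<phi> v) = k" by simp
  qed
  have dist: "l2dist (\<phi> v) (\<phi> w) = l2dist v w"
    if v: "v \<in> box_vertices d a" and w: "w \<in> box_vertices d a" for v w
  proof -
    \<comment> \<open>If \<open>v t = w t\<close> the two pairs coincide and
      \<open>pair_dist2\<close> is 0; otherwise they share the middle element
      \<open>s (3 * t + 1)\<close> and it is 6.\<close>
    have "(a t)\<^sup>2 / 6 * pair_dist2 (f v t) (g v t) (f w t) (g w t) = (v t - w t)\<^sup>2" if "t < d" for t
      using v w a[OF that] that unfolding box_vertices_def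
      by (auto simp: f_def g_def e_def pair_dist2_def s_eq dest!: spec[of _ t])
    then show ?thesis
      unfolding \<phi>_def by (simp add: l2dist_shift_point fg l2dist_box_vertices[OF v w])
  qed
  have "inj_on \<phi> (box_vertices d a)"
  proof (rule inj_onI)
    fix v w assume v: "v \<in> box_vertices d a" and w: "w \<in> box_vertices d a" and "\<phi> v = \<phi> w"
    then have "l2dist v w = 0"
      using dist[OF v w] by (simp add: l2dist_def)
    then have "\<forall>t<d. v t = w t"
      by (simp add: l2dist_box_vertices[OF v w] sum_nonneg_eq_0_iff)
    moreover have "v t = w t" if "\<not> t < d" for t
      using v w that by (simp add: box_vertices_def)
    ultimately show "v = w" by blast
  qed
  then have "congruent_to (box_vertices d a) (\<phi> ` box_vertices d a)"
    unfolding congruent_to_def using dist by (auto intro: inj_on_imp_bij_betw)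
  with colour show "\<exists>S k. S \<subseteq> shift_config d a \<and> congruent_to (box_vertices d a) S \<and> (\<forall>x\<in>S. c x = k)"
    by (intro exI[of _ "\<phi> ` box_vertices d a"] exI[of _ k]) auto
qed

subsection \<open>Directed cuts\<close>

text \<open>The sets counted arise by adding \<open>i\<close> to an arbitrary subset of
  \<open>V - {i, j}\<close>.\<close>

lemma card_separating_subsets:
  assumes "finite V" "i \<in> V" "j \<in> V" "i \<noteq> j"
  shows "4 * card {A \<in> Pow V. i \<in> A \<and> j \<notin> A} = 2 ^ card V"
proof -
  have "{A \<in> Pow V. i \<in> A \<and> j \<notin> A} = insert i ` Pow (V - {i, j})"
  proof (intro equalityI subsetI)
    fix A assume "A \<in> {A \<in> Pow V. i \<in> A \<and> j \<notin> A}"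
    then show "A \<in> insert i ` Pow (V - {i, j})"
      by (intro image_eqI[of _ _ "A - {i}"]) auto
  qed (use assms in auto)
  moreover have "inj_on (insert i) (Pow (V - {i, j}))"
    by (rule inj_onI) blast
  ultimately have "card {A \<in> Pow V. i \<in> A \<and> j \<notin> A} = 2 ^ card (V - {i, j})"
    using assms(1) by (simp add: card_image card_Pow)
  moreover have "card V = card (V - {i, j}) + 2"
    using assms card_Diff_subset[of "{i, j}" V] card_mono[of V "{i, j}"] by simp
  ultimately show ?thesis by (simp add: power_add)
qed

text \<open>Double counting over all subsets \<open>A\<close> of the finite set of end points: each
  \<open>x\<close> is cut by exactly a quarter of them, so some \<open>A\<close> reaches the
  average.\<close>

lemma exists_directed_cut:
  fixes p q :: "'a \<Rightarrow> 'b"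
  assumes "finite E" "\<And>x. x \<in> E \<Longrightarrow> p x \<noteq> q x"
  shows "\<exists>A. card E \<le> 4 * card {x \<in> E. p x \<in> A \<and> q x \<notin> A}"
proof (rule ccontr)
  assume "\<not> ?thesis"
  then have less: "4 * card {x \<in> E. p x \<in> A \<and> q x \<notin> A} < card E" for A
    by (simp add: not_le)
  define V where "V = p ` E \<union> q ` E"
  have V: "finite V" using assms(1) by (simp add: V_def)
  have "(\<Sum>A\<in>Pow V. 4 * card {x \<in> E. p x \<in> A \<and> q x \<notin> A})
      = (\<Sum>A\<in>Pow V. \<Sum>x\<in>E. if p x \<in> A \<and> q x \<notin> A then 4 else 0)"
    using assms(1) by (simp add: sum.inter_filter[symmetric] mult.commute)
  also have "\<dots> = (\<Sum>x\<in>E. \<Sum>A\<in>Pow V. if p x \<in> A \<and> q x \<notin> A then 4 else 0)"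
    by (rule sum.swap)
  also have "\<dots> = (\<Sum>x\<in>E. 4 * card {A \<in> Pow V. p x \<in> A \<and> q x \<notin> A})"
    using V by (simp add: sum.inter_filter[symmetric] mult.commute del: Pow_iff)
  also have "\<dots> = (\<Sum>x\<in>E. 2 ^ card V)"
    using V assms(2) by (intro sum.cong refl card_separating_subsets) (auto simp: V_def)
  also have "\<dots> = (\<Sum>A\<in>Pow V. card E)"
    using V by (simp add: card_Pow)
  finally have "(\<Sum>A\<in>Pow V. 4 * card {x \<in> E. p x \<in> A \<and> q x \<notin> A}) = (\<Sum>A\<in>Pow V. card E)" .
  moreover have "(\<Sum>A\<in>Pow V. 4 * card {x \<in> E. p x \<in> A \<and> q x \<notin> A}) < (\<Sum>A\<in>Pow V. card E)"
    using V less by (intro sum_strict_mono) auto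
  ultimately show False by simp
qed

lemma shift_config_dense_without_diameter:
  assumes a: "\<And>t. t < d \<Longrightarrow> a t \<noteq> 0" and d: "0 < d"
    and E: "finite E" "E \<subseteq> shift_config d a"
  shows "\<exists>Z\<subseteq>E. card E \<le> 4 * card Z \<and> (\<forall>y\<in>Z. \<forall>z\<in>Z. l2dist y z \<noteq> sqrt (\<Sum>t<d. (a t)\<^sup>2))"
proof -
  have "\<forall>y\<in>E. \<exists>f g. y = shift_point d a f g \<and> (\<forall>t<d. f t < g t)"
    using E(2) by (auto simp: shift_config_def)
  then obtain f g where y: "\<And>y. y \<in> E \<Longrightarrow> y = shift_point d a (f y) (g y)"
    and fg: "\<And>y t. y \<in> E \<Longrightarrow> t < d \<Longrightarrow> f y t < g y t"
    by metis
  have "f y 0 \<noteq> g y 0" if "y \<in> E" for y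
    using fg[OF that d] by simp
  with E(1) obtain A where A: "card E \<le> 4 * card {y \<in> E. f y 0 \<in> A \<and> g y 0 \<notin> A}"
    using exists_directed_cut[of E "\<lambda>y. f y 0" "\<lambda>y. g y 0"] by blast
  have "l2dist y z \<noteq> sqrt (\<Sum>t<d. (a t)\<^sup>2)"
    if "y \<in> {y \<in> E. f y 0 \<in> A \<and> g y 0 \<notin> A}" "z \<in> {y \<in> E. f y 0 \<in> A \<and> g y 0 \<notin> A}" for y z
  proof
    assume "l2dist y z = sqrt (\<Sum>t<d. (a t)\<^sup>2)"
    then have "l2dist (shift_point d a (f y) (g y)) (shift_point d a (f z) (g z))
        = sqrt (\<Sum>t<d. (a t)\<^sup>2)"
      using that y by simp
    \<comment> \<open>Either equality would put one number both inside and outside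
      \<open>A\<close>.\<close>
    then have "f y 0 = g z 0 \<or> g y 0 = f z 0"
      using that by (intro diameter_attained_imp_consecutive[of d _ _ _ _ a] fg a d) auto
    then show False using that by auto
  qed
  with A show ?thesis
    by (intro exI[of _ "{y \<in> E. f y 0 \<in> A \<and> g y 0 \<notin> A}"]) auto
qed

theorem theorem1p4:
  fixes d :: nat and B :: "(nat \<Rightarrow> real) set"
  assumes "d \<ge> 1" and "is_brick d B"
  shows "P_Ramsey B"
proof -
  obtain a where B: "B \<subseteq> Rinf" "congruent_to B (box_vertices d a)"
    and a: "\<And>t. t < d \<Longrightarrow> 0 < a t"
    using assms(2) unfolding is_brick_def by blast
  obtain h where h: "bij_betw h B (box_vertices d a)"
    and h_dist: "\<And>x y. x \<in> B \<Longrightarrow> y \<in> B \<Longrightarrow> l2dist (h x) (h y) = l2dist x y"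
    using B(2) unfolding congruent_to_def by blast
  \<comment> \<open>The diagonal is pulled back to \<open>B\<close>, so every copy of
    \<open>B\<close> contains two points at this distance.\<close>
  obtain u v where uv: "u \<in> B" "v \<in> B" "l2dist u v = sqrt (\<Sum>t<d. (a t)\<^sup>2)"
    using box_diagonal[of d a] h_dist unfolding bij_betw_imp_surj_on[OF h, symmetric] by auto
  have "finite B"
    using bij_betw_finite[OF h] finite_box_vertices by blast
  moreover have "arrows (shift_config d a) B r" for r
    unfolding arrows_def
  proof (intro allI impI)
    fix c :: "(nat \<Rightarrow> real) \<Rightarrow> nat" assume "c ` shift_config d a \<subseteq> {..<r}"
    moreover have "arrows (shift_config d a) (box_vertices d a) r"
      using a by (rule arrows_shift_config_box)
    ultimately have "\<exists>S k. S \<subseteq> shift_config d a \<and> congruent_to (box_vertices d a) S \<and> (\<forall>x\<in>S. c x = k)"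
      by (simp only: arrows_def)
    then show "\<exists>S k. S \<subseteq> shift_config d a \<and> congruent_to B S \<and> (\<forall>x\<in>S. c x = k)"
      using congruent_to_trans[OF B(2)] by blast
  qed
  moreover have "\<exists>Z\<subseteq>E. 1 / 4 * real (card E) \<le> real (card Z) \<and> config_free B Z"
    if E: "E \<subseteq> shift_config d a" "finite E" for E
  proof -
    have "\<And>t. t < d \<Longrightarrow> a t \<noteq> 0" "0 < d"
      using a assms(1) by fastforce+
    then obtain Z where Z: "Z \<subseteq> E" "card E \<le> 4 * card Z"
      "\<And>y z. y \<in> Z \<Longrightarrow> z \<in> Z \<Longrightarrow> l2dist y z \<noteq> sqrt (\<Sum>t<d. (a t)\<^sup>2)"
      using shift_config_dense_without_diameter[of d a E] E by blast
    have "config_free B Z"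
      unfolding config_free_def congruent_to_def
    proof clarify
      fix S f assume "S \<subseteq> Z" "bij_betw f B S" "\<forall>x\<in>B. \<forall>y\<in>B. l2dist (f x) (f y) = l2dist x y"
      then show False using uv Z(3)[of "f u" "f v"] by (auto dest: bij_betwE)
    qed
    with Z(1,2) show ?thesis by (intro exI[of _ Z]) linarith
  qed
  ultimately show ?thesis
    unfolding P_Ramsey_def using B(1) shift_config_subset_Rinf
    by (intro conjI exI[of _ "shift_config d a"] exI[of _ "1 / 4"]) auto
qed

end
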